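(* Let $m\ge 1$ be an integer and let $\boldsymbol{p}_m=(p_0,\dots,p_{m-1})\in(0,1)^m$. Put $\rho_i=\frac{1-p_i}{p_i}$ for $0\le i\le m-1$ and $\gamma=\prod_{i=0}^{m-1}\rho_i$, and suppose $\gamma<1$. Then the velocity of the cyclic birth and death chain with parameters $\boldsymbol{p}_m$ is \[v(\boldsymbol{p}_m)=\frac{1-\gamma}{1-\gamma+\frac{2}{m}\sum_{r=1}^{m}P_r},\qquad\text{where } P_r=\sum_{k=0}^{m-1}\prod_{i=0}^{r-1}\rho_{(k+i)\bmod m}.\]
   Context: For $m\in\mathbb{N}$ (positive integers) and $\boldsymbol{p}_m=(p_0,\dots,p_{m-1})\in(0,1)^m$, the cyclic birth and death chain (CBD) with parameters $\boldsymbol{p}_m$ is the discrete-time, time-homogeneous Markov chain $X=(X_n)_{n\ge 0}$ on $\mathbb{Z}$ with transition probabilities $p_{i,i+1}=p_{i \bmod m}$ and $p_{i,i-1}=1-p_{i\bmod m}$ for every $i\in\mathbb{Z}$ (all other transition probabilities being $0$). Its velocity is $v(\boldsymbol{p}_m):=\lim_{n\to\infty}n^{-1}X_n$; this limit exists almost surely, is a deterministic constant, and does not depend on the starting state. *)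

theory Defs
  imports "HOL-Probability.Probability"
begin

text \<open>Time-homogeneous Markov chains with integer states and transition probabilities \<open>K i j\<close>;
  the initial distribution is arbitrary.\<close>

definition markov_chain :: "'a measure \<Rightarrow> (nat \<Rightarrow> 'a \<Rightarrow> int) \<Rightarrow> (int \<Rightarrow> int \<Rightarrow> real) \<Rightarrow> bool" where
  "markov_chain M X K \<longleftrightarrow>
     prob_space M \<and>
     (\<forall>n. X n \<in> measurable M (count_space UNIV)) \<and>
     (\<forall>n (x :: nat \<Rightarrow> int) j.
        \<P>(\<omega> in M. \<forall>k\<le>n. X k \<omega> = x k) > 0 \<longrightarrow>
        \<P>(\<omega> in M. X (Suc n) \<omega> = j \<bar> \<forall>k\<le>n. X k \<omega> = x k) = K (x n) j)"

text \<open>Only the values \<open>p 0, \<dots>, p (m - 1)\<close> of the parameter function are used;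
  \<open>i mod int m\<close> is nonnegative for negative \<open>i\<close> as well.\<close>

definition cbd_transition :: "nat \<Rightarrow> (nat \<Rightarrow> real) \<Rightarrow> int \<Rightarrow> int \<Rightarrow> real" where
  "cbd_transition m p i j =
     (if j = i + 1 then p (nat (i mod int m))
      else if j = i - 1 then 1 - p (nat (i mod int m))
      else 0)"

definition cbd_chain :: "nat \<Rightarrow> (nat \<Rightarrow> real) \<Rightarrow> 'a measure \<Rightarrow> (nat \<Rightarrow> 'a \<Rightarrow> int) \<Rightarrow> bool" where
  "cbd_chain m p M X \<longleftrightarrow> markov_chain M X (cbd_transition m p)"

definition has_velocity :: "'a measure \<Rightarrow> (nat \<Rightarrow> 'a \<Rightarrow> int) \<Rightarrow> real \<Rightarrow> bool" where
  "has_velocity M X v \<longleftrightarrow>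
     (AE \<omega> in M. (\<lambda>n. real_of_int (X n \<omega>) / real n) \<longlonglongrightarrow> v)"

text \<open>The velocity is the common almost sure limit for all chains with the given parameters,
  whatever the initial distribution. A definition cannot quantify over types, so the chains
  here live on the type of trajectories; the law of every chain is realized there.
  Since chains exist, at most one \<open>v\<close> satisfies the description.\<close>

definition cbd_velocity :: "nat \<Rightarrow> (nat \<Rightarrow> real) \<Rightarrow> real" where
  "cbd_velocity m p =
     (THE v. \<forall>(M :: (nat \<Rightarrow> int) measure) X. cbd_chain m p M X \<longrightarrow> has_velocity M X v)"

definition cbd_rho :: "(nat \<Rightarrow> real) \<Rightarrow> nat \<Rightarrow> real" where
  "cbd_rho p i = (1 - p i) / p i"

definition cbd_gamma :: "nat \<Rightarrow> (nat \<Rightarrow> real) \<Rightarrow> real" where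
  "cbd_gamma m p = (\<Prod>i<m. cbd_rho p i)"

definition cbd_P :: "nat \<Rightarrow> (nat \<Rightarrow> real) \<Rightarrow> nat \<Rightarrow> real" where
  "cbd_P m p r = (\<Sum>k<m. \<Prod>i<r. cbd_rho p ((k + i) mod m))"

end

theory Submission
  imports Defs
begin

text \<open>Let \<open>R i = (1 - p i) / p i\<close>, extended periodically to \<open>\<int>\<close>. The expected time \<open>w i\<close> to go from
  \<open>i\<close> to \<open>i + 1\<close> is the periodic solution of \<open>w i = 1 + R i + R i * w (i - 1)\<close>, which is explicit
  when \<open>\<gamma> < 1\<close>. A primitive \<open>T\<close> of \<open>w\<close> has drift exactly one along the chain, so \<open>T (X n) - n\<close> is a
  martingale with bounded increments; Hoeffding's lemma, Chernoff's bound and the Borel--Cantelli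
  lemma give \<open>T (X n) / n \<longrightarrow> 1\<close> almost surely. Since \<open>T i\<close> differs from \<open>(c / m) * i\<close> by a bounded
  amount, where \<open>c = w 0 + \<dots> + w (m - 1)\<close>, the velocity is \<open>m / c\<close>. The chain is realized
  on an infinite product of its transition laws, so that the definite description defining the
  velocity has a unique solution.\<close>

section \<open>Integration along the history of a Markov chain\<close>

lemma nn_integral_countable_valued:
  fixes Q :: "'a \<Rightarrow> 'b :: countable"
  assumes [measurable]: "Q \<in> measurable M (count_space UNIV)"
  shows "(\<integral>\<^sup>+\<omega>. f (Q \<omega>) \<partial>M) =
         (\<integral>\<^sup>+q. emeasure M {\<omega> \<in> space M. Q \<omega> = q} * f q \<partial>count_space UNIV)"
proof -
  \<comment> \<open>Pointwise only the term \<open>q = Q \<omega>\<close> of the inner sum survives;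
    the range is countable, so sum and integral can be interchanged.\<close>
  have "(\<integral>\<^sup>+\<omega>. f (Q \<omega>) \<partial>M) =
        (\<integral>\<^sup>+\<omega>. (\<integral>\<^sup>+q. indicator {\<omega> \<in> space M. Q \<omega> = q} \<omega> * f q \<partial>count_space UNIV) \<partial>M)"
  proof (rule nn_integral_cong)
    fix \<omega> assume "\<omega> \<in> space M"
    then show "f (Q \<omega>) = (\<integral>\<^sup>+q. indicator {\<omega> \<in> space M. Q \<omega> = q} \<omega> * f q \<partial>count_space UNIV)"
      by (subst nn_integral_count_space'[where A = "{Q \<omega>}"]) auto
  qed
  also have "\<dots> = (\<integral>\<^sup>+q. (\<integral>\<^sup>+\<omega>. indicator {\<omega> \<in> space M. Q \<omega> = q} \<omega> * f q \<partial>M) \<partial>count_space UNIV)"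
    by (intro nn_integral_count_space_nn_integral) auto
  also have "\<dots> = (\<integral>\<^sup>+q. emeasure M {\<omega> \<in> space M. Q \<omega> = q} * f q \<partial>count_space UNIV)"
    by (intro nn_integral_cong, subst nn_integral_multc) auto
  finally show ?thesis .
qed

text \<open>Recording the history as a list keeps it in a countable type, so measurability can be
  checked on single fibres, each a finite conjunction of conditions on coordinates.\<close>

lemma measurable_path:
  fixes X :: "nat \<Rightarrow> 'a \<Rightarrow> 'b :: countable"
  assumes "\<And>k. X k \<in> measurable M (count_space UNIV)"
  shows "(\<lambda>\<omega>. map (\<lambda>k. X k \<omega>) [0..<n]) \<in> measurable M (count_space UNIV)"
proof -
  note [measurable] = assms
  have "{\<omega> \<in> space M. map (\<lambda>k. X k \<omega>) [0..<n] = xs} \<in> sets M" for xs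
  proof (cases "length xs = n")
    case True
    then have "{\<omega> \<in> space M. map (\<lambda>k. X k \<omega>) [0..<n] = xs} = {\<omega> \<in> space M. \<forall>k<n. X k \<omega> = xs ! k}"
      by (auto simp: list_eq_iff_nth_eq)
    then show ?thesis by simp
  next
    case False
    then have "map (\<lambda>k. X k \<omega>) [0..<n] \<noteq> xs" for \<omega>
      by auto
    then show ?thesis by simp
  qed
  then show ?thesis
    by (auto simp: measurable_count_space_eq2_countable vimage_def Int_def conj_commute)
qed

text \<open>The product form of the Markov property also covers histories of probability zero, where
  conditioning says nothing: there both sides vanish. Lists of the wrong length give empty
  events.\<close>

lemma markov_chain_emeasure_step:
  assumes mc: "markov_chain M X K" and K: "\<And>i j. K i j \<ge> 0"
  shows "emeasure M {\<omega> \<in> space M. map (\<lambda>k. X k \<omega>) [0..<Suc n] = xs \<and> X (Suc n) \<omega> = j} =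
         emeasure M {\<omega> \<in> space M. map (\<lambda>k. X k \<omega>) [0..<Suc n] = xs} * ennreal (K (last xs) j)"
proof (cases "length xs = Suc n")
  case len: True
  from mc interpret prob_space M by (simp add: markov_chain_def)
  have [measurable]: "X k \<in> measurable M (count_space UNIV)" for k
    using mc by (simp add: markov_chain_def)
  let ?E = "{\<omega> \<in> space M. \<forall>k\<le>n. X k \<omega> = xs ! k}"
  let ?F = "{\<omega> \<in> space M. X (Suc n) \<omega> = j \<and> (\<forall>k\<le>n. X k \<omega> = xs ! k)}"
  have path: "map (\<lambda>k. X k \<omega>) [0..<Suc n] = xs \<longleftrightarrow> (\<forall>k\<le>n. X k \<omega> = xs ! k)" for \<omega>
    using len by (auto simp: list_eq_iff_nth_eq less_Suc_eq_le simp del: upt_Suc)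
  have last: "last xs = xs ! n"
    using len by (cases xs) (auto simp: last_conv_nth)
  have "prob ?F = prob ?E * K (xs ! n) j"
  proof (cases "prob ?E > 0")
    case True
    then have "\<P>(\<omega> in M. X (Suc n) \<omega> = j \<bar> \<forall>k\<le>n. X k \<omega> = xs ! k) = K (xs ! n) j"
      using mc unfolding markov_chain_def by auto
    with True show ?thesis
      by (simp add: cond_prob_def field_simps)
  next
    case False
    then have "prob ?E = 0"
      using measure_nonneg[of M ?E] by linarith
    moreover have "prob ?F \<le> prob ?E"
      by (intro finite_measure_mono) auto
    ultimately show ?thesis
      using measure_nonneg[of M ?F] by simp
  qed
  moreover have "{\<omega> \<in> space M. map (\<lambda>k. X k \<omega>) [0..<Suc n] = xs \<and> X (Suc n) \<omega> = j} = ?F"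
    unfolding path by auto
  moreover have "{\<omega> \<in> space M. map (\<lambda>k. X k \<omega>) [0..<Suc n] = xs} = ?E"
    unfolding path by auto
  ultimately show ?thesis
    by (simp add: emeasure_eq_measure last K flip: ennreal_mult)
next
  case False
  then have "{\<omega> \<in> space M. map (\<lambda>k. X k \<omega>) [0..<Suc n] = xs \<and> X (Suc n) \<omega> = j} = {}"
            "{\<omega> \<in> space M. map (\<lambda>k. X k \<omega>) [0..<Suc n] = xs} = {}"
    by auto
  then show ?thesis by (simp only:) simp
qed

text \<open>Tower property for nonnegative integrands: the last step is averaged over the kernel
  while any function \<open>u\<close> of the past is kept. Both sides are sums over countably many
  histories.\<close>

lemma markov_chain_nn_integral_step:
  fixes \<kappa> :: "int \<Rightarrow> int pmf"
  assumes mc: "markov_chain M X (\<lambda>i j. pmf (\<kappa> i) j)"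
  shows "(\<integral>\<^sup>+\<omega>. u (map (\<lambda>k. X k \<omega>) [0..<Suc n]) * g (X n \<omega>) (X (Suc n) \<omega>) \<partial>M) =
         (\<integral>\<^sup>+\<omega>. u (map (\<lambda>k. X k \<omega>) [0..<Suc n]) * (\<integral>\<^sup>+j. g (X n \<omega>) j \<partial>\<kappa> (X n \<omega>)) \<partial>M)"
proof -
  let ?p = "\<lambda>\<omega>. map (\<lambda>k. X k \<omega>) [0..<Suc n]"
  have X: "X k \<in> measurable M (count_space UNIV)" for k
    using mc by (simp add: markov_chain_def)
  note p [measurable] = measurable_path[OF X, where n = "Suc n"]
  note [measurable] = X
  \<comment> \<open>Reading \<open>X n\<close> off the history makes the integrand a function of one
    countable-valued variable, the pair of history and next state.\<close>
  have last: "X n \<omega> = last (?p \<omega>)" for \<omega>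
    by simp
  have pX: "(\<lambda>\<omega>. (?p \<omega>, X (Suc n) \<omega>)) \<in> measurable M (count_space UNIV)"
    by measurable
  let ?F = "\<lambda>z. u (fst z) * g (last (fst z)) (snd z)"
  have "(\<integral>\<^sup>+\<omega>. u (?p \<omega>) * g (X n \<omega>) (X (Suc n) \<omega>) \<partial>M) =
        (\<integral>\<^sup>+\<omega>. ?F (?p \<omega>, X (Suc n) \<omega>) \<partial>M)"
    by simp
  also have "\<dots> = (\<integral>\<^sup>+z. emeasure M {\<omega> \<in> space M. (?p \<omega>, X (Suc n) \<omega>) = z} * ?F z \<partial>count_space UNIV)"
    by (rule nn_integral_countable_valued[OF pX])
  also have "\<dots> = (\<integral>\<^sup>+xs. (\<integral>\<^sup>+j. emeasure M {\<omega> \<in> space M. (?p \<omega>, X (Suc n) \<omega>) = (xs, j)} * ?F (xs, j)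
                       \<partial>count_space UNIV) \<partial>count_space UNIV)"
    by (rule nn_integral_fst_count_space[symmetric])
  also have "\<dots> = (\<integral>\<^sup>+xs. emeasure M {\<omega> \<in> space M. ?p \<omega> = xs} *
                       (u xs * (\<integral>\<^sup>+j. g (last xs) j \<partial>\<kappa> (last xs))) \<partial>count_space UNIV)"
  proof (rule nn_integral_cong)
    fix xs :: "int list"
    have "emeasure M {\<omega> \<in> space M. (?p \<omega>, X (Suc n) \<omega>) = (xs, j)} * ?F (xs, j) =
          (emeasure M {\<omega> \<in> space M. ?p \<omega> = xs} * u xs) * (ennreal (pmf (\<kappa> (last xs)) j) * g (last xs) j)" for j
      using markov_chain_emeasure_step[OF mc, of n xs j] by (simp del: upt_Suc add: mult_ac)
    then have "(\<integral>\<^sup>+j. emeasure M {\<omega> \<in> space M. (?p \<omega>, X (Suc n) \<omega>) = (xs, j)} * ?F (xs, j) \<partial>count_space UNIV) =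
          (\<integral>\<^sup>+j. (emeasure M {\<omega> \<in> space M. ?p \<omega> = xs} * u xs) *
                 (ennreal (pmf (\<kappa> (last xs)) j) * g (last xs) j) \<partial>count_space UNIV)"
      by (simp only:)
    also have "\<dots> = (emeasure M {\<omega> \<in> space M. ?p \<omega> = xs} * u xs) *
          (\<integral>\<^sup>+j. ennreal (pmf (\<kappa> (last xs)) j) * g (last xs) j \<partial>count_space UNIV)"
      by (rule nn_integral_cmult) simp
    finally show "(\<integral>\<^sup>+j. emeasure M {\<omega> \<in> space M. (?p \<omega>, X (Suc n) \<omega>) = (xs, j)} * ?F (xs, j) \<partial>count_space UNIV) =
               emeasure M {\<omega> \<in> space M. ?p \<omega> = xs} * (u xs * (\<integral>\<^sup>+j. g (last xs) j \<partial>\<kappa> (last xs)))"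
      unfolding nn_integral_measure_pmf mult.assoc .
  qed
  also have "\<dots> = (\<integral>\<^sup>+\<omega>. u (?p \<omega>) * (\<integral>\<^sup>+j. g (last (?p \<omega>)) j \<partial>\<kappa> (last (?p \<omega>))) \<partial>M)"
    by (rule nn_integral_countable_valued[OF p, symmetric])
  finally show ?thesis
    unfolding last .
qed

section \<open>Exponential moments and a law of large numbers\<close>

text \<open>Each step multiplies the moment by at most \<open>exp c\<close>, whatever the past.
  Subtracting \<open>g (X 0 \<omega>)\<close> keeps the moment finite for an arbitrary initial
  distribution.\<close>

lemma markov_chain_exp_moment:
  fixes \<kappa> :: "int \<Rightarrow> int pmf" and g :: "int \<Rightarrow> real"
  assumes mc: "markov_chain M X (\<lambda>i j. pmf (\<kappa> i) j)"
    and step: "\<And>i. (\<integral>\<^sup>+j. ennreal (exp (g j - g i)) \<partial>\<kappa> i) \<le> ennreal (exp c)"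
  shows "(\<integral>\<^sup>+\<omega>. ennreal (exp (g (X n \<omega>) - g (X 0 \<omega>))) \<partial>M) \<le> ennreal (exp (real n * c))"
proof (induction n)
  case 0
  from mc interpret prob_space M by (simp add: markov_chain_def)
  show ?case by (simp add: emeasure_space_1)
next
  case (Suc n)
  have [measurable]: "X k \<in> measurable M (count_space UNIV)" for k
    using mc by (simp add: markov_chain_def)
  define u where "u xs = ennreal (exp (g (last xs) - g (hd xs)))" for xs :: "int list"
  have u: "u (map (\<lambda>k. X k \<omega>) [0..<Suc n]) = ennreal (exp (g (X n \<omega>) - g (X 0 \<omega>)))" for \<omega>
    by (simp add: u_def upt_conv_Cons hd_append)
  have "(\<integral>\<^sup>+\<omega>. ennreal (exp (g (X (Suc n) \<omega>) - g (X 0 \<omega>))) \<partial>M) =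
        (\<integral>\<^sup>+\<omega>. ennreal (exp (g (X n \<omega>) - g (X 0 \<omega>))) *
               ennreal (exp (g (X (Suc n) \<omega>) - g (X n \<omega>))) \<partial>M)"
    by (intro nn_integral_cong) (simp flip: ennreal_mult exp_add)
  also have "\<dots> = (\<integral>\<^sup>+\<omega>. ennreal (exp (g (X n \<omega>) - g (X 0 \<omega>))) *
               (\<integral>\<^sup>+j. ennreal (exp (g j - g (X n \<omega>))) \<partial>\<kappa> (X n \<omega>)) \<partial>M)"
    using markov_chain_nn_integral_step[OF mc, where u = u and g = "\<lambda>i j. ennreal (exp (g j - g i))" and n = n]
    unfolding u .
  also have "\<dots> \<le> (\<integral>\<^sup>+\<omega>. ennreal (exp (g (X n \<omega>) - g (X 0 \<omega>))) * ennreal (exp c) \<partial>M)"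
    by (intro nn_integral_mono mult_left_mono step) auto
  also have "\<dots> = (\<integral>\<^sup>+\<omega>. ennreal (exp (g (X n \<omega>) - g (X 0 \<omega>))) \<partial>M) * ennreal (exp c)"
    by (rule nn_integral_multc) measurable
  also have "\<dots> \<le> ennreal (exp (real n * c)) * ennreal (exp c)"
    by (intro mult_right_mono Suc.IH) auto
  also have "\<dots> = ennreal (exp (real (Suc n) * c))"
    by (simp add: algebra_simps flip: ennreal_mult exp_add)
  finally show ?case .
qed

text \<open>Only the upper side is treated, since the lower one is the same statement for
  \<open>- g\<close>.\<close>

lemma markov_chain_upper_drift:
  fixes \<kappa> :: "int \<Rightarrow> int pmf" and g :: "int \<Rightarrow> real"
  assumes mc: "markov_chain M X (\<lambda>i j. pmf (\<kappa> i) j)"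
    and B: "B > 0" "\<And>i j. j \<in> set_pmf (\<kappa> i) \<Longrightarrow> \<bar>g j - g i\<bar> \<le> B"
    and drift: "\<And>i. measure_pmf.expectation (\<kappa> i) (\<lambda>j. g j - g i) = v"
    and \<epsilon>: "\<epsilon> > 0"
  shows "AE \<omega> in M. \<forall>\<^sub>F n in sequentially. g (X n \<omega>) - g (X 0 \<omega>) < (v + \<epsilon>) * real n"
proof -
  from mc interpret prob_space M by (simp add: markov_chain_def)
  have [measurable]: "X k \<in> measurable M (count_space UNIV)" for k
    using mc by (simp add: markov_chain_def)
  \<comment> \<open>minimizes the exponent \<open>l\<^sup>2 * B\<^sup>2 / 2 - l * \<epsilon>\<close> of the Chernoff bound\<close>
  define l where "l = \<epsilon> / B\<^sup>2"
  define A where "A n = {\<omega> \<in> space M. g (X n \<omega>) - g (X 0 \<omega>) \<ge> (v + \<epsilon>) * real n}" for n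
  have l: "l > 0" using B \<epsilon> by (simp add: l_def)
  have step: "(\<integral>\<^sup>+j. ennreal (exp (l * g j - l * g i)) \<partial>\<kappa> i) \<le> ennreal (exp (l * v + l\<^sup>2 * B\<^sup>2 / 2))" for i
  proof -
    interpret b: interval_bounded_random_variable "measure_pmf (\<kappa> i)" "\<lambda>j. g j - g i" "- B" B
      using B(2)[of _ i] by unfold_locales (fastforce simp: AE_measure_pmf_iff abs_le_iff)+
    have "(\<integral>\<^sup>+j. ennreal (exp (l * g j - l * g i)) \<partial>\<kappa> i) =
          (\<integral>\<^sup>+j. ennreal (exp (l * v)) * ennreal (exp (l * (g j - g i - v))) \<partial>\<kappa> i)"
      by (intro nn_integral_cong) (simp add: algebra_simps flip: ennreal_mult exp_add)
    also have "\<dots> = ennreal (exp (l * v)) * (\<integral>\<^sup>+j. ennreal (exp (l * (g j - g i - v))) \<partial>\<kappa> i)"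
      by (rule nn_integral_cmult) simp
    \<comment> \<open>Hoeffding's lemma on an interval of length \<open>2 * B\<close>; its constant
      \<open>(2 * B)^2 / 8\<close> is \<open>B^2 / 2\<close>.\<close>
    also have "\<dots> \<le> ennreal (exp (l * v)) * ennreal (exp (l\<^sup>2 * (B - - B)\<^sup>2 / 8))"
      using b.Hoeffdings_lemma_nn_integral[OF l] unfolding drift
      by (intro mult_left_mono) (auto simp: algebra_simps)
    also have "\<dots> = ennreal (exp (l * v + l\<^sup>2 * B\<^sup>2 / 2))"
      by (simp add: power2_eq_square flip: ennreal_mult exp_add)
    finally show ?thesis .
  qed
  have bound: "prob (A n) \<le> exp (- (l * \<epsilon> / 2)) ^ n" for n
  proof -
    have "emeasure M (A n) \<le> ennreal (exp (- l * ((v + \<epsilon>) * real n))) *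
            (\<integral>\<^sup>+\<omega>. ennreal (exp (l * (g (X n \<omega>) - g (X 0 \<omega>)))) * indicator (space M) \<omega> \<partial>M)"
      unfolding A_def using l by (intro Chernoff_ineq_nn_integral_ge) auto
    also have "(\<integral>\<^sup>+\<omega>. ennreal (exp (l * (g (X n \<omega>) - g (X 0 \<omega>)))) * indicator (space M) \<omega> \<partial>M) =
               (\<integral>\<^sup>+\<omega>. ennreal (exp (l * g (X n \<omega>) - l * g (X 0 \<omega>))) \<partial>M)"
      by (intro nn_integral_cong) (simp add: algebra_simps)
    also have "ennreal (exp (- l * ((v + \<epsilon>) * real n))) * \<dots> \<le>
        ennreal (exp (- l * ((v + \<epsilon>) * real n))) * ennreal (exp (real n * (l * v + l\<^sup>2 * B\<^sup>2 / 2)))"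
      using markov_chain_exp_moment[OF mc, of "\<lambda>i. l * g i", OF step] by (intro mult_left_mono) auto
    also have "\<dots> = ennreal (exp (real n * - (l * \<epsilon> / 2)))"
    proof -
      \<comment> \<open>For this \<open>l\<close> the quadratic term is half of the gain
        \<open>l * \<epsilon>\<close> from the threshold, so a factor
        \<open>exp (- (l * \<epsilon> / 2))\<close> per step remains.\<close>
      have "l\<^sup>2 * B\<^sup>2 = l * \<epsilon>"
        using B by (simp add: l_def power2_eq_square)
      then show ?thesis
        by (simp add: algebra_simps flip: ennreal_mult exp_add)
    qed
    finally show ?thesis
      unfolding exp_of_nat_mult by (simp add: emeasure_eq_measure)
  qed
  have "summable (\<lambda>n. prob (A n))"
  proof (rule summable_comparison_test'[where N = 0])
    show "summable (\<lambda>n. exp (- (l * \<epsilon> / 2)) ^ n)"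
      using l \<epsilon> by (intro summable_geometric) simp
  qed (use bound in simp)
  then have "AE \<omega> in M. \<forall>\<^sub>F n in sequentially. \<omega> \<in> space M - A n"
    by (intro borel_cantelli_AE1) (auto simp: A_def emeasure_eq_measure)
  then show ?thesis
    by (rule AE_mp) (auto simp: A_def elim: eventually_mono intro!: AE_I2)
qed

lemma markov_chain_drift_LLN:
  fixes \<kappa> :: "int \<Rightarrow> int pmf" and g :: "int \<Rightarrow> real"
  assumes mc: "markov_chain M X (\<lambda>i j. pmf (\<kappa> i) j)"
    and B: "\<And>i j. j \<in> set_pmf (\<kappa> i) \<Longrightarrow> \<bar>g j - g i\<bar> \<le> B"
    and drift: "\<And>i. measure_pmf.expectation (\<kappa> i) (\<lambda>j. g j - g i) = v"
  shows "AE \<omega> in M. (\<lambda>n. g (X n \<omega>) / real n) \<longlonglongrightarrow> v"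
proof -
  \<comment> \<open>A countable family of tolerances, so that the exceptional null sets unite to a
    null set.\<close>
  define e where "e k = inverse (real (Suc k))" for k
  \<comment> \<open>The one-sided bound asks for a positive constant, hence
    \<open>max B 1\<close>.\<close>
  have up: "AE \<omega> in M. \<forall>\<^sub>F n in sequentially. g (X n \<omega>) - g (X 0 \<omega>) < (v + e k) * real n" for k
    by (rule markov_chain_upper_drift[OF mc, where B = "max B 1"])
       (use drift in \<open>auto simp: e_def intro: order.trans[OF B]\<close>)
  have low: "AE \<omega> in M. \<forall>\<^sub>F n in sequentially. - g (X n \<omega>) - - g (X 0 \<omega>) < (- v + e k) * real n" for k
  proof (rule markov_chain_upper_drift[OF mc, where B = "max B 1"])
    fix i
    have "measure_pmf.expectation (\<kappa> i) (\<lambda>j. - g j - - g i) =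
          measure_pmf.expectation (\<kappa> i) (\<lambda>j. - (g j - g i))"
      by (simp add: algebra_simps)
    also have "\<dots> = - v"
      unfolding integral_minus drift ..
    finally show "measure_pmf.expectation (\<kappa> i) (\<lambda>j. - g j - - g i) = - v" .
  next
    fix i j assume "j \<in> set_pmf (\<kappa> i)"
    from B[OF this] show "\<bar>- g j - - g i\<bar> \<le> max B 1" by linarith
  qed (auto simp: e_def)
  have "AE \<omega> in M. \<forall>k. \<forall>\<^sub>F n in sequentially. \<bar>g (X n \<omega>) - g (X 0 \<omega>) - v * real n\<bar> < e k * real n"
    unfolding AE_all_countable
  proof
    fix k
    show "AE \<omega> in M. \<forall>\<^sub>F n in sequentially. \<bar>g (X n \<omega>) - g (X 0 \<omega>) - v * real n\<bar> < e k * real n"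
      using up[of k] low[of k]
    proof eventually_elim
      case (elim \<omega>)
      then show ?case
        by eventually_elim (simp add: abs_less_iff algebra_simps)
    qed
  qed
  then show ?thesis
  proof eventually_elim
    case (elim \<omega>)
    have "(\<lambda>n. (g (X n \<omega>) - g (X 0 \<omega>)) / real n) \<longlonglongrightarrow> v"
    proof (rule tendstoI)
      fix r :: real assume "r > 0"
      then obtain k where k: "e k < r"
        using reals_Archimedean by (auto simp: e_def)
      from elim[rule_format, of k] eventually_gt_at_top[of 0]
      show "\<forall>\<^sub>F n in sequentially. dist ((g (X n \<omega>) - g (X 0 \<omega>)) / real n) v < r"
      proof eventually_elim
        case (elim n)
        then have "(g (X n \<omega>) - g (X 0 \<omega>)) / real n - v = (g (X n \<omega>) - g (X 0 \<omega>) - v * real n) / real n"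
          by (simp add: field_simps)
        then have "dist ((g (X n \<omega>) - g (X 0 \<omega>)) / real n) v =
                   \<bar>g (X n \<omega>) - g (X 0 \<omega>) - v * real n\<bar> / real n"
          by (simp only: dist_real_def) simp
        also have "\<dots> < e k"
          using elim by (simp add: field_simps)
        finally show ?case using k by simp
      qed
    qed
    \<comment> \<open>For fixed \<omega> the starting value is a constant, so its share
      vanishes.\<close>
    moreover have "(\<lambda>n. g (X 0 \<omega>) / real n) \<longlonglongrightarrow> 0"
      by (rule tendsto_divide_0[OF tendsto_const filterlim_at_top_imp_at_infinity[OF filterlim_real_sequentially]])
    ultimately have "(\<lambda>n. (g (X n \<omega>) - g (X 0 \<omega>)) / real n + g (X 0 \<omega>) / real n) \<longlonglongrightarrow> v + 0"
      by (rule tendsto_add)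
    then show ?case
      by (simp add: diff_divide_distrib)
  qed
qed

section \<open>Construction of the chain\<close>

lemma markov_chain_exists:
  fixes \<kappa> :: "int \<Rightarrow> int pmf"
  shows "\<exists>(M :: (nat \<Rightarrow> int) measure) X. markov_chain M X (\<lambda>i j. pmf (\<kappa> i) j)"
proof -
  \<comment> \<open>Coordinate \<open>to_nat (n, x)\<close> holds in advance the state that follows
    if the chain sits in \<open>x\<close> at time \<open>n\<close>. These draws are independent, so
    a product measure suffices.\<close>
  define N where "N k = measure_pmf (\<kappa> (snd (from_nat k :: nat \<times> int)))" for k
  interpret N: prob_space "N k" for k
    by (simp add: N_def measure_pmf.prob_space_axioms)
  interpret product_prob_space N UNIV ..
  define M where "M = PiM UNIV N"
  define X :: "nat \<Rightarrow> (nat \<Rightarrow> int) \<Rightarrow> int"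
    where "X n \<omega> = rec_nat 0 (\<lambda>n x. \<omega> (to_nat (n, x))) n" for n \<omega>
  have X_simps [simp]: "X 0 \<omega> = 0" "X (Suc n) \<omega> = \<omega> (to_nat (n, X n \<omega>))" for n \<omega>
    by (simp_all add: X_def)
  have comp: "(\<lambda>\<omega>. \<omega> k) \<in> measurable M (count_space UNIV)" for k
  proof -
    have "(\<lambda>\<omega>. \<omega> k) \<in> measurable M (N k)"
      unfolding M_def by (rule measurable_component_singleton) simp
    moreover have "sets (N k) = sets (count_space UNIV)"
      by (simp add: N_def)
    ultimately show ?thesis
      using measurable_cong_sets[OF refl] by blast
  qed
  have meas: "X n \<in> measurable M (count_space UNIV)" for n
  proof (induction n)
    case 0
    have "X 0 = (\<lambda>_. 0)" by (simp add: fun_eq_iff)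
    then show ?case by simp
  next
    case (Suc n)
    have "X (Suc n) = (\<lambda>\<omega>. \<omega> (to_nat (n, X n \<omega>)))" by (simp add: fun_eq_iff)
    \<comment> \<open>The index of the coordinate that is read is random, but it takes countably
      many values.\<close>
    then show ?case
      using measurable_compose_countable[OF comp Suc, of "\<lambda>x. to_nat (n, x)"] by simp
  qed
  \<comment> \<open>a trajectory reads a fresh coordinate at every time, so path events are cylinders\<close>
  have path: "(\<forall>k\<le>n. X k \<omega> = x k) \<longleftrightarrow> x 0 = 0 \<and> (\<forall>k<n. \<omega> (to_nat (k, x k)) = x (Suc k))"
    for n \<omega> x
    by (induction n) (auto simp: le_Suc_eq less_Suc_eq)
  have path_prob: "measure M {\<omega> \<in> space M. \<forall>k\<le>n. X k \<omega> = x k} =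
      (if x 0 = 0 then \<Prod>k<n. pmf (\<kappa> (x k)) (x (Suc k)) else 0)" for n x
  proof (cases "x 0 = 0")
    case True
    define J where "J = (\<lambda>k. to_nat (k, x k)) ` {..<n}"
    define A where "A i = {x (Suc (fst (from_nat i :: nat \<times> int)))}" for i
    have "{\<omega> \<in> space M. \<forall>k\<le>n. X k \<omega> = x k} = {\<omega> \<in> space M. \<forall>i\<in>J. \<omega> i \<in> A i}"
      using True unfolding path by (auto simp: J_def A_def)
    moreover have "emeasure M {\<omega> \<in> space M. \<forall>i\<in>J. \<omega> i \<in> A i} = (\<Prod>i\<in>J. emeasure (N i) (A i))"
      unfolding M_def by (rule emeasure_PiM_Collect) (auto simp: J_def N_def)
    \<comment> \<open>Distinct times read distinct coordinates even if a state recurs, so the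
      reindexing is injective.\<close>
    moreover have "(\<Prod>i\<in>J. emeasure (N i) (A i)) = (\<Prod>k<n. ennreal (pmf (\<kappa> (x k)) (x (Suc k))))"
      unfolding J_def by (subst prod.reindex) (auto simp: inj_on_def N_def A_def emeasure_pmf_single)
    ultimately show ?thesis
      using True by (simp add: measure_def prod_ennreal prod_nonneg)
  qed (simp add: path)
  have "markov_chain M X (\<lambda>i j. pmf (\<kappa> i) j)"
    unfolding markov_chain_def
  proof (intro conjI allI impI meas)
    show "prob_space M"
      unfolding M_def by (rule prob_space_axioms)
  next
    fix n and x :: "nat \<Rightarrow> int" and j
    assume pos: "\<P>(\<omega> in M. \<forall>k\<le>n. X k \<omega> = x k) > 0"
    \<comment> \<open>Overwriting \<open>x\<close> at \<open>Suc n\<close> by \<open>j\<close> makes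
      the joint event a path event one step longer, whose probability gains exactly one
      factor.\<close>
    have "(X (Suc n) \<omega> = j \<and> (\<forall>k\<le>n. X k \<omega> = x k)) \<longleftrightarrow> (\<forall>k\<le>Suc n. X k \<omega> = (x(Suc n := j)) k)" for \<omega>
      by (auto simp: le_Suc_eq)
    then have "\<P>(\<omega> in M. X (Suc n) \<omega> = j \<and> (\<forall>k\<le>n. X k \<omega> = x k)) =
               \<P>(\<omega> in M. \<forall>k\<le>Suc n. X k \<omega> = (x(Suc n := j)) k)"
      by simp
    also have "\<dots> = \<P>(\<omega> in M. \<forall>k\<le>n. X k \<omega> = x k) * pmf (\<kappa> (x n)) j"
      unfolding path_prob by simp
    finally show "\<P>(\<omega> in M. X (Suc n) \<omega> = j \<bar> \<forall>k\<le>n. X k \<omega> = x k) = pmf (\<kappa> (x n)) j"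
      using pos by (simp add: cond_prob_def)
  qed
  then show ?thesis by blast
qed

section \<open>Periodic coefficients and mean crossing times\<close>

text \<open>Moving the window by one trades its first term for an equal one at the end; induction in
  both directions does the rest. Stated for a commutative monoid, it serves sums and products
  alike.\<close>

lemma (in comm_monoid_set) periodic_shift:
  assumes per: "\<And>i :: int. g (i + int m) = g i"
  shows "F (\<lambda>k. g (a + int k)) {..<m} = F (\<lambda>k. g (int k)) {..<m}"
proof -
  have step: "F (\<lambda>k. g (b + 1 + int k)) {..<m} = F (\<lambda>k. g (b + int k)) {..<m}" for b
  proof (cases m)
    case (Suc n)
    have "F (\<lambda>k. g (b + 1 + int k)) {..<Suc n} = F (\<lambda>k. g (b + 1 + int k)) {..<n} \<^bold>* g (b + int m)"
      by (simp add: Suc add_ac)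
    also have "\<dots> = F (\<lambda>k. g (b + int k)) {..<Suc n}"
      unfolding lessThan_Suc_shift by (simp add: per commute add_ac)
    finally show ?thesis by (simp add: Suc)
  qed simp
  show ?thesis
  proof (induction a rule: int_induct[where k = 0])
    case (step2 i)
    then show ?case using step[of "i - 1"] by simp
  qed (simp_all add: step)
qed

text \<open>Unrolling the recursion of the crossing times \<open>r\<close> times puts this product
  in front of \<open>w (i - r)\<close>. Ascending factors make it, for \<open>r = m\<close>, a
  window to which \<open>periodic_shift\<close> applies.\<close>

definition back_prod :: "(int \<Rightarrow> real) \<Rightarrow> nat \<Rightarrow> int \<Rightarrow> real" where
  "back_prod R r i = (\<Prod>l<r. R (i + 1 - int r + int l))"

lemma back_prod_0 [simp]: "back_prod R 0 i = 1"
  by (simp add: back_prod_def)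

lemma back_prod_Suc: "back_prod R (Suc r) i = R i * back_prod R r (i - 1)"
  by (simp add: back_prod_def)

lemma back_prod_shift:
  assumes "\<And>i. R (i + int m) = R i"
  shows "back_prod R r (i + int m) = back_prod R r i"
  unfolding back_prod_def using assms[of "i + 1 - int r + int l" for l]
  by (simp add: algebra_simps)

lemma back_prod_period:
  assumes "\<And>i. R (i + int m) = R i"
  shows "back_prod R m i = (\<Prod>l<m. R (int l))"
  unfolding back_prod_def by (rule prod.periodic_shift) (rule assms)

text \<open>Links the backward products of the recursion to the forward products in
  \<open>cbd_P\<close>: the windows start \<open>r - 1\<close> places earlier, but their starting
  points still run through a full period.\<close>

lemma sum_back_prod:
  assumes "\<And>i. R (i + int m) = R i"
  shows "(\<Sum>k<m. back_prod R r (int k)) = (\<Sum>k<m. \<Prod>l<r. R (int k + int l))"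
proof -
  have "(\<Sum>k<m. back_prod R r (int k)) = (\<Sum>k<m. \<Prod>l<r. R (1 - int r + int k + int l))"
    by (simp add: back_prod_def algebra_simps)
  also have "\<dots> = (\<Sum>k<m. \<Prod>l<r. R (int k + int l))"
  proof (rule sum.periodic_shift)
    fix i
    show "(\<Prod>l<r. R (i + int m + int l)) = (\<Prod>l<r. R (i + int l))"
      using assms[of "i + int l" for l] by (simp add: algebra_simps)
  qed
  finally show ?thesis .
qed

text \<open>Expected time from \<open>i\<close> to \<open>i + 1\<close>: iterating \<open>w i = 1 + R i + R i * w (i - 1)\<close> once around the
  cycle gives \<open>w i = (\<Sum>j<m. \<dots>) + \<gamma> * w i\<close>.\<close>

definition crossing_time :: "nat \<Rightarrow> (int \<Rightarrow> real) \<Rightarrow> int \<Rightarrow> real" where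
  "crossing_time m R i =
     (\<Sum>j<m. back_prod R j i + back_prod R (Suc j) i) / (1 - (\<Prod>l<m. R (int l)))"

lemma crossing_time_shift:
  assumes "\<And>i. R (i + int m) = R i"
  shows "crossing_time m R (i + int m) = crossing_time m R i"
  using assms by (simp add: crossing_time_def back_prod_shift)

text \<open>The numerator at \<open>i\<close> and \<open>R i\<close> times the one at
  \<open>i - 1\<close> telescope; the boundary terms \<open>1 + R i\<close> and
  \<open>\<gamma> + R i * \<gamma>\<close> leave \<open>(1 + R i) * (1 - \<gamma>)\<close>.\<close>

lemma crossing_time_recursion:
  assumes per: "\<And>i. R (i + int m) = R i" and "(\<Prod>l<m. R (int l)) \<noteq> 1"
  shows "crossing_time m R i = 1 + R i + R i * crossing_time m R (i - 1)"
proof -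
  let ?\<gamma> = "\<Prod>l<m. R (int l)" and ?D = "\<lambda>r. back_prod R r i"
  have "R i * (\<Sum>j<m. back_prod R j (i - 1) + back_prod R (Suc j) (i - 1)) =
        (\<Sum>j<m. ?D (Suc j) + ?D (Suc (Suc j)))"
    by (simp add: back_prod_Suc[of R _ i] sum_distrib_left distrib_left)
  moreover have "(\<Sum>j<m. ?D j + ?D (Suc j)) - (\<Sum>j<m. ?D (Suc j) + ?D (Suc (Suc j))) =
        (?D 0 + ?D 1) - (?D m + ?D (Suc m))"
    unfolding sum_subtractf[symmetric] by (subst sum_lessThan_telescope') simp
  moreover have "?D m = ?\<gamma>" "?D (Suc m) = R i * ?\<gamma>" "?D 1 = R i"
    by (simp_all add: back_prod_period[of R m, OF per] back_prod_Suc)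
  ultimately have "(\<Sum>j<m. ?D j + ?D (Suc j)) =
      (1 + R i) * (1 - ?\<gamma>) + R i * (\<Sum>j<m. back_prod R j (i - 1) + back_prod R (Suc j) (i - 1))"
    by (simp add: algebra_simps)
  with assms(2) show ?thesis
    by (simp add: crossing_time_def add_divide_distrib)
qed

text \<open>Exchanging the sums gives the sum of \<open>P j\<close> plus that of
  \<open>P (Suc j)\<close> over \<open>j < m\<close>. They differ by \<open>P 0 - P m\<close>, which
  is the term \<open>real m * (1 - \<gamma>)\<close>; hence also the factor 2.\<close>

lemma sum_crossing_time:
  assumes per: "\<And>i. R (i + int m) = R i"
  defines "\<gamma> \<equiv> \<Prod>l<m. R (int l)"
  shows "(\<Sum>k<m. crossing_time m R (int k)) =
    (real m * (1 - \<gamma>) + 2 * (\<Sum>r=1..m. \<Sum>k<m. \<Prod>l<r. R (int k + int l))) / (1 - \<gamma>)"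
proof -
  define P where "P r = (\<Sum>k<m. back_prod R r (int k))" for r
  have P: "P r = (\<Sum>k<m. \<Prod>l<r. R (int k + int l))" for r
    unfolding P_def by (rule sum_back_prod[of R m, OF per])
  have "P 0 = real m" "P m = real m * \<gamma>"
    by (simp_all add: P_def \<gamma>_def back_prod_period[of R m, OF per])
  have "(\<Sum>k<m. \<Sum>j<m. back_prod R j (int k) + back_prod R (Suc j) (int k)) =
        (\<Sum>j<m. P j) + (\<Sum>j<m. P (Suc j))"
    by (subst sum.swap) (simp add: P_def sum.distrib)
  also have "(\<Sum>j<m. P (Suc j)) = (\<Sum>r=1..m. P r)"
    by (simp add: sum.atLeast1_atMost_eq)
  also have "(\<Sum>j<m. P j) = (\<Sum>j<m. P (Suc j)) + P 0 - P m"
    using sum.lessThan_Suc_shift[of P m] by simp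
  also have "(\<Sum>j<m. P (Suc j)) = (\<Sum>r=1..m. P r)"
    by (simp add: sum.atLeast1_atMost_eq)
  finally show ?thesis
    using \<open>P 0 = real m\<close> \<open>P m = real m * \<gamma>\<close>
    by (simp add: crossing_time_def P \<gamma>_def flip: sum_divide_distrib) (simp add: algebra_simps)
qed

section \<open>Primitive of a periodic function\<close>

text \<open>For \<open>w\<close> of period \<open>m \<ge> 1\<close>, the discrete primitive that
  vanishes at 0. Flooring division lets one formula serve negative \<open>i\<close> too.\<close>

definition periodic_primitive :: "nat \<Rightarrow> (int \<Rightarrow> real) \<Rightarrow> int \<Rightarrow> real" where
  "periodic_primitive m w i =
     (\<Sum>k<m. w (int k)) * of_int (i div int m) + (\<Sum>k<nat (i mod int m). w (int k))"

lemma periodic_mod: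
  assumes "\<And>i :: int. w (i + int m) = w i"
  shows "w (i mod int m) = w i"
proof -
  have up: "w (i + int m * int n) = w i" for i n
  proof (induction n)
    case (Suc n)
    then show ?case
      using assms[of "i + int m * int n"] by (simp add: algebra_simps)
  qed simp
  have "w (i + int m * k) = w i" for k
  proof (cases "k \<ge> 0")
    case True
    then show ?thesis using up[of i "nat k"] by simp
  next
    case False
    then show ?thesis using up[of "i + int m * k" "nat (- k)"] by simp
  qed
  moreover have "i + int m * - (i div int m) = i mod int m"
    by (simp add: minus_mult_div_eq_mod)
  ultimately show ?thesis by metis
qed

text \<open>Inside a period the partial sum gains \<open>w i\<close>. At the end of a period the
  partial sum, which lacks only \<open>w (int (m - 1))\<close>, is reset while a full sum is
  added.\<close>

lemma periodic_primitive_step: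
  assumes "m \<ge> 1" and per: "\<And>i. w (i + int m) = w i"
  shows "periodic_primitive m w (i + 1) = periodic_primitive m w i + w i"
proof (cases "i mod int m + 1 = int m")
  case True
  have i: "i = int m * (i div int m) + (int m - 1)"
    using True mult_div_mod_eq[of "int m" i] by linarith
  then have "i + 1 = int m * (i div int m + 1)"
    by (simp add: algebra_simps)
  then have "(i + 1) div int m = i div int m + 1" "(i + 1) mod int m = 0"
    using assms(1) by simp_all
  moreover have "w i = w (int (m - 1))"
  proof -
    have "i mod int m = int (m - 1)"
      using True assms(1) by (simp add: of_nat_diff)
    then show ?thesis
      using periodic_mod[of w m i, OF per] by simp
  qed
  moreover have "nat (i mod int m) = m - 1"
    using True by linarith
  moreover have "(\<Sum>k<m. w (int k)) = (\<Sum>k<m - 1. w (int k)) + w (int (m - 1))"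
    using assms(1) by (cases m) simp_all
  ultimately show ?thesis
    by (simp add: periodic_primitive_def algebra_simps)
next
  case False
  have r: "0 \<le> i mod int m" "i mod int m < int m"
    using assms(1) by simp_all
  have "i + 1 = (i mod int m + 1) + int m * (i div int m)"
    by simp
  then have "(i + 1) div int m = i div int m" "(i + 1) mod int m = i mod int m + 1"
    using r False by (simp_all only: div_mult_self2 mod_mult_self2) (simp_all add: div_pos_pos_trivial mod_pos_pos_trivial)
  moreover have "nat (i mod int m + 1) = Suc (nat (i mod int m))"
    using r by simp
  moreover have "w (int (nat (i mod int m))) = w i"
    using r periodic_mod[of w m i, OF per] by simp
  ultimately show ?thesis
    by (simp add: periodic_primitive_def)
qed

text \<open>With \<open>i = m * q + r\<close> the terms in \<open>q\<close> cancel, and what remains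
  involves less than one period.\<close>

lemma periodic_primitive_linear:
  assumes "m \<ge> 1"
  shows "\<bar>real m * periodic_primitive m w i - (\<Sum>k<m. w (int k)) * of_int i\<bar> \<le>
         2 * real m * (\<Sum>k<m. \<bar>w (int k)\<bar>)"
proof -
  let ?c = "\<Sum>k<m. w (int k)" and ?b = "\<Sum>k<m. \<bar>w (int k)\<bar>" and ?r = "i mod int m"
  have r: "0 \<le> ?r" "?r < int m"
    using assms by simp_all
  have "of_int i = of_int (int m * (i div int m) + ?r)"
    by simp
  then have i: "(of_int i :: real) = real m * of_int (i div int m) + of_int ?r"
    by (simp only: of_int_add of_int_mult of_int_of_nat_eq)
  have "real m * periodic_primitive m w i - ?c * of_int i =
        real m * (\<Sum>k<nat ?r. w (int k)) - ?c * of_int ?r"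
    unfolding i by (simp add: periodic_primitive_def algebra_simps)
  also have "\<bar>\<dots>\<bar> \<le> real m * \<bar>\<Sum>k<nat ?r. w (int k)\<bar> + \<bar>?c\<bar> * of_int ?r"
    using r by (intro order.trans[OF abs_triangle_ineq4]) (simp add: abs_mult)
  also have "\<dots> \<le> real m * ?b + ?b * real m"
  proof (intro add_mono mult_mono)
    show "\<bar>\<Sum>k<nat ?r. w (int k)\<bar> \<le> ?b"
      using r by (intro order.trans[OF sum_abs] sum_mono2) auto
  qed (use r in \<open>auto intro: sum_nonneg\<close>)
  finally show ?thesis by simp
qed

section \<open>The velocity of the cyclic chain\<close>

text \<open>A distribution in place of bare transition probabilities, so that steps can be
  integrated over and the general law of large numbers applies.\<close>

definition cbd_kernel :: "nat \<Rightarrow> (nat \<Rightarrow> real) \<Rightarrow> int \<Rightarrow> int pmf" where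
  "cbd_kernel m p i =
     map_pmf (\<lambda>b. if b then i + 1 else i - 1) (bernoulli_pmf (p (nat (i mod int m))))"

lemma pmf_cbd_kernel:
  assumes "0 < p (nat (i mod int m))" "p (nat (i mod int m)) < 1"
  shows "pmf (cbd_kernel m p i) j = cbd_transition m p i j"
proof -
  have "(\<lambda>b. if b then i + 1 else i - 1) -` {j} =
        (if j = i + 1 then {True} else if j = i - 1 then {False} else {})"
    by (auto split: if_splits)
  with assms show ?thesis
    by (simp add: cbd_kernel_def pmf_map cbd_transition_def measure_pmf_single)
qed

lemma set_pmf_cbd_kernel: "set_pmf (cbd_kernel m p i) \<subseteq> {i + 1, i - 1}"
  by (auto simp: cbd_kernel_def)

lemma expectation_cbd_kernel:
  assumes "0 < p (nat (i mod int m))" "p (nat (i mod int m)) < 1"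
  shows "measure_pmf.expectation (cbd_kernel m p i) h =
    p (nat (i mod int m)) * h (i + 1) + (1 - p (nat (i mod int m))) * (h (i - 1) :: real)"
  using assms by (simp add: cbd_kernel_def algebra_simps)

lemma
  assumes m: "m \<ge> 1" and p: "\<forall>i<m. 0 < p i \<and> p i < 1" and \<gamma>: "cbd_gamma m p < 1"
  shows cbd_chain_has_velocity:
    "cbd_chain m p M X \<Longrightarrow> has_velocity M X
       ((1 - cbd_gamma m p) / (1 - cbd_gamma m p + 2 / real m * (\<Sum>r=1..m. cbd_P m p r)))"
  and cbd_chain_exists:
    "\<exists>(M' :: (nat \<Rightarrow> int) measure) X'. cbd_chain m p M' X'"
proof -
  have pi: "0 < p (nat (i mod int m))" "p (nat (i mod int m)) < 1" for i
    using p m by (simp_all add: nat_less_iff)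
  have kernel: "cbd_transition m p = (\<lambda>i j. pmf (cbd_kernel m p i) j)"
    by (intro ext) (simp add: pmf_cbd_kernel pi)
  show "\<exists>(M' :: (nat \<Rightarrow> int) measure) X'. cbd_chain m p M' X'"
    unfolding cbd_chain_def kernel by (rule markov_chain_exists)
  assume "cbd_chain m p M X"
  then have mc: "markov_chain M X (\<lambda>i j. pmf (cbd_kernel m p i) j)"
    by (simp add: cbd_chain_def kernel)
  define R where "R i = cbd_rho p (nat (i mod int m))" for i
  define w where "w = crossing_time m R"
  define T where "T = periodic_primitive m w"
  define c where "c = (\<Sum>k<m. w (int k))"
  define b where "b = (\<Sum>k<m. \<bar>w (int k)\<bar>)"
  have per: "R (i + int m) = R i" for i
    by (simp add: R_def)
  have R_pos: "R i > 0" for i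
    using pi[of i] by (simp add: R_def cbd_rho_def)
  have gamma: "(\<Prod>l<m. R (int l)) = cbd_gamma m p"
    by (simp add: R_def cbd_gamma_def)
  have P: "(\<Sum>k<m. \<Prod>l<r. R (int k + int l)) = cbd_P m p r" for r
    unfolding R_def cbd_P_def
    by (intro sum.cong prod.cong refl) (simp flip: of_nat_add zmod_int)
  have P_nonneg: "cbd_P m p r \<ge> 0" for r
    unfolding P[symmetric] by (intro sum_nonneg prod_nonneg) (simp add: less_imp_le[OF R_pos])
  have w_per: "w (i + int m) = w i" for i
    unfolding w_def by (rule crossing_time_shift) (rule per)
  have T_step: "T (i + 1) = T i + w i" for i
    unfolding T_def by (rule periodic_primitive_step[OF m]) (rule w_per)
  have w_bound: "\<bar>w i\<bar> \<le> b" for i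
  proof -
    have "\<bar>w (int (nat (i mod int m)))\<bar> \<le> b"
      unfolding b_def using m by (intro member_le_sum) (auto simp: nat_less_iff)
    then show ?thesis
      using m periodic_mod[of w m i, OF w_per] by simp
  qed
  have T_lim: "AE \<omega> in M. (\<lambda>n. T (X n \<omega>) / real n) \<longlonglongrightarrow> 1"
  proof (rule markov_chain_drift_LLN[OF mc])
    fix i j assume "j \<in> set_pmf (cbd_kernel m p i)"
    then consider "j = i + 1" | "j = i - 1"
      using set_pmf_cbd_kernel by blast
    then show "\<bar>T j - T i\<bar> \<le> b"
      using T_step[of i] T_step[of "i - 1"] w_bound[of i] w_bound[of "i - 1"] by cases auto
  next
    fix i
    let ?p = "p (nat (i mod int m))"
    have "measure_pmf.expectation (cbd_kernel m p i) (\<lambda>j. T j - T i) = ?p * w i - (1 - ?p) * w (i - 1)"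
      unfolding expectation_cbd_kernel[of p i m, OF pi] using T_step[of i] T_step[of "i - 1"]
      by (simp add: algebra_simps)
    also have "w i = 1 + R i + R i * w (i - 1)"
      unfolding w_def by (rule crossing_time_recursion) (use \<gamma> in \<open>simp_all add: per gamma\<close>)
    \<comment> \<open>As \<open>?p * R i = 1 - ?p\<close>, the terms in \<open>w (i - 1)\<close>
      cancel and \<open>?p * (1 + R i) = 1\<close> is left.\<close>
    also have "?p * \<dots> - (1 - ?p) * w (i - 1) = 1"
      using pi[of i] by (simp add: R_def cbd_rho_def field_simps)
    finally show "measure_pmf.expectation (cbd_kernel m p i) (\<lambda>j. T j - T i) = 1" .
  qed
  have c: "c = (real m * (1 - cbd_gamma m p) + 2 * (\<Sum>r=1..m. cbd_P m p r)) / (1 - cbd_gamma m p)"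
    unfolding c_def w_def using sum_crossing_time[of R m, OF per] by (simp only: gamma P)
  have "c > 0"
    unfolding c using m \<gamma> P_nonneg by (intro divide_pos_pos add_pos_nonneg mult_pos_pos) (auto intro: sum_nonneg)
  have v: "(1 - cbd_gamma m p) / (1 - cbd_gamma m p + 2 / real m * (\<Sum>r=1..m. cbd_P m p r)) = real m / c"
    (is "?v = _") using m by (simp add: c field_simps)
  from T_lim have "AE \<omega> in M. (\<lambda>n. real_of_int (X n \<omega>) / real n) \<longlonglongrightarrow> ?v"
  proof eventually_elim
    case (elim \<omega>)
    \<comment> \<open>The error of the linear approximation to \<open>T\<close>; its numerator is
      bounded uniformly in the state.\<close>
    define d where "d n = (real m * T (X n \<omega>) - c * of_int (X n \<omega>)) / real n" for n
    have "d \<longlonglongrightarrow> 0"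
    proof (rule tendsto_rabs_zero_cancel, rule tendsto_sandwich[OF _ _ tendsto_const])
      show "(\<lambda>n. 2 * real m * b / real n) \<longlonglongrightarrow> 0"
        by (rule tendsto_divide_0[OF tendsto_const filterlim_at_top_imp_at_infinity[OF filterlim_real_sequentially]])
      show "\<forall>\<^sub>F n in sequentially. \<bar>d n\<bar> \<le> 2 * real m * b / real n"
        unfolding d_def T_def c_def b_def abs_divide abs_of_nat
        by (intro always_eventually allI divide_right_mono periodic_primitive_linear m) auto
    qed auto
    then have "(\<lambda>n. (real m * (T (X n \<omega>) / real n) - d n) / c) \<longlonglongrightarrow> (real m * 1 - 0) / c"
      using \<open>c > 0\<close> by (intro tendsto_intros elim) auto
    \<comment> \<open>The equality of functions includes \<open>n = 0\<close>, where division by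
      zero makes both sides zero.\<close>
    also have "(\<lambda>n. (real m * (T (X n \<omega>) / real n) - d n) / c) = (\<lambda>n. real_of_int (X n \<omega>) / real n)"
      using \<open>c > 0\<close> by (intro ext) (simp add: d_def diff_divide_distrib)
    finally show ?case
      unfolding v by simp
  qed
  then show "has_velocity M X ?v"
    unfolding has_velocity_def .
qed

text \<open>An almost sure statement not involving \<omega> is true on a probability space; on a
  null measure every \<open>v\<close> would be a velocity.\<close>

lemma has_velocity_unique:
  assumes "prob_space M" "has_velocity M X v" "has_velocity M X v'"
  shows "v = v'"
proof -
  interpret prob_space M by fact
  have "AE \<omega> in M. v = v'"
    using assms(2,3) unfolding has_velocity_def by eventually_elim (rule LIMSEQ_unique)
  then show ?thesis by simp
qed

lemma cbd_velocity_eq: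
  assumes "m \<ge> 1" and "\<forall>i<m. 0 < p i \<and> p i < 1" and "cbd_gamma m p < 1"
  shows "cbd_velocity m p =
    (1 - cbd_gamma m p) / (1 - cbd_gamma m p + 2 / real m * (\<Sum>r=1..m. cbd_P m p r))"
  unfolding cbd_velocity_def
proof (rule the_equality)
  fix v
  assume v: "\<forall>(M :: (nat \<Rightarrow> int) measure) X. cbd_chain m p M X \<longrightarrow> has_velocity M X v"
  obtain M :: "(nat \<Rightarrow> int) measure" and X where MX: "cbd_chain m p M X"
    using cbd_chain_exists[OF assms] by blast
  moreover have "prob_space M"
    using MX by (simp add: cbd_chain_def markov_chain_def)
  ultimately show "v = (1 - cbd_gamma m p) / (1 - cbd_gamma m p + 2 / real m * (\<Sum>r=1..m. cbd_P m p r))"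
    using v cbd_chain_has_velocity[OF assms] has_velocity_unique by blast
qed (use cbd_chain_has_velocity[OF assms] in blast)

theorem proposition2:
  fixes m :: nat and p :: "nat \<Rightarrow> real"
  assumes "m \<ge> 1"
    and "\<forall>i<m. 0 < p i \<and> p i < 1"
    and "cbd_gamma m p < 1"
  shows "(\<forall>(M :: 'a measure) X. cbd_chain m p M X \<longrightarrow> has_velocity M X (cbd_velocity m p)) \<and>
    cbd_velocity m p =
      (1 - cbd_gamma m p) / (1 - cbd_gamma m p + 2 / real m * (\<Sum>r=1..m. cbd_P m p r))"
  \<comment> \<open>The limit lemma is polymorphic in the sample space, so the value determined on
    trajectories is the limit for chains on any \<open>'a\<close>.\<close>
  unfolding cbd_velocity_eq[OF assms] using cbd_chain_has_velocity[OF assms] by blast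

end
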